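(* Let $n,r$ be positive integers and $N=(n-1)(r-1)$. Let $\mathbf x=\{x_1,\ldots,x_r\}$ be a set of $r$ indeterminates, let $\xi$ be an indeterminate, let $\mathbf y=\{y_1,\ldots,y_n\}$ be the set of roots of $y^n-1$ and let $\mathbf z=\{z_1,\ldots,z_n\}$ be the set of roots of $z^n-\xi^n$. Then $$\Delta(\mathbf y)\,\Delta(\mathbf z)\,\left|\prod_{k=1}^r (x_k y_i-z_j)^{-1}\right|_{i,j=1,\ldots,n}=\frac{(-1)^{(n-1)(n/2+r-1)}}{\prod_{k=1}^r (x_k^n-\xi^n)^n}\ \prod_{i=0}^{n-1}\left(\sum_{j=0}^{\infty}\varphi_{N+i-nj}\,\xi^{nj}\right).$$
   Context: $|a_{ij}|_{i,j=1,\ldots,n}$ denotes the determinant of the $n\times n$ matrix $(a_{ij})$. For a set $\mathbf w=\{w_1,\ldots,w_n\}$ (with a fixed ordering, the same as used for indexing rows/columns of the matrix), $\Delta(\mathbf w)=\prod_{1\le i<j\le n}(w_i-w_j)$. For $k\in\mathbb Z$, $\varphi_k$ is the sum of all monomial symmetric functions $m_\mu(x_1,\ldots,x_r)$ over partitions $\mu=(\mu_1\ge\cdots\ge\mu_r\ge0)$ of $k$ with at most $r$ parts and largest part $\mu_1\le n-1$; thus $\varphi_0=1$, $\varphi_k=0$ for $k<0$ and for $k>(n-1)r$ (so the inner sums are finite).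
   Formalization: The factors Δ(y)Δ(z) on the left are replaced by their inverses Δ(y)^{-1}Δ(z)^{-1}; as printed the identity fails for every n ≥ 2 (n=2, r=1: the left side is -16xξ²/(x²-ξ²)², the right side is -x/(x²-ξ²)²). *)

theory Defs
  imports
    "Jordan_Normal_Form.Determinant"
    "HOL-Library.Poly_Mapping"
    "HOL-Library.Groups_Big_Fun"
    "HOL-Computational_Algebra.Fraction_Field"
    "HOL-Computational_Algebra.Polynomial"
    "HOL-Combinatorics.Multiset_Permutations"
begin

(* Rational functions over 'a in indeterminates X_0, X_1, X_2, ...: the fraction field of the
   polynomial ring, where a monomial is a finitely supported exponent map nat \<Rightarrow>\<^sub>0 nat. *)
type_synonym 'a ratfun = "((nat \<Rightarrow>\<^sub>0 nat) \<Rightarrow>\<^sub>0 'a) fract"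

definition indet :: "nat \<Rightarrow> 'a::idom ratfun" where
  "indet k = Fract (Poly_Mapping.single (Poly_Mapping.single k 1) 1) 1"

definition Delta :: "nat \<Rightarrow> (nat \<Rightarrow> 'b::comm_ring_1) \<Rightarrow> 'b" where
  "Delta n w = (\<Prod>j<n. \<Prod>i<j. w i - w j)"

(* Partitions of k with at most r parts, all of them at most m, padded with zeros to length r. *)
definition bounded_partitions :: "nat \<Rightarrow> nat \<Rightarrow> int \<Rightarrow> nat list set" where
  "bounded_partitions r m k =
     {mu. length mu = r \<and> sorted_wrt (\<ge>) mu \<and> int (sum_list mu) = k \<and> (\<forall>p\<in>set mu. p \<le> m)}"

(* The monomial symmetric function of mu in x 0, ..., x (r - 1), for mu of length r: every
   distinct rearrangement of mu contributes one monomial. *)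
definition monomial_symmetric :: "nat \<Rightarrow> (nat \<Rightarrow> 'b::comm_semiring_1) \<Rightarrow> nat list \<Rightarrow> 'b" where
  "monomial_symmetric r x mu =
     (\<Sum>alpha\<in>permutations_of_multiset (mset mu). \<Prod>k<r. x k ^ (alpha ! k))"

definition phi :: "nat \<Rightarrow> nat \<Rightarrow> (nat \<Rightarrow> 'b::comm_semiring_1) \<Rightarrow> int \<Rightarrow> 'b" where
  "phi n r x k = (\<Sum>mu\<in>bounded_partitions r (n - 1) k. monomial_symmetric r x mu)"

lemma finite_bounded_partitions: "finite (bounded_partitions r m k)"
proof (rule finite_subset)
  show "bounded_partitions r m k \<subseteq> {mu. set mu \<subseteq> {..m} \<and> length mu = r}"
    by (auto simp: bounded_partitions_def)
qed (rule finite_lists_length_eq, simp)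

lemma phi_neg: "k < 0 \<Longrightarrow> phi n r x k = 0"
  by (simp add: phi_def bounded_partitions_def)

(* Sum_any yields 0 on functions of infinite support; this is not the case for the series
   over j that occurs with phi. *)
lemma finite_support_phi_series:
  assumes "n > 0"
  shows "finite {j::nat. phi n r x (a - int (n * j)) * c j \<noteq> 0}"
proof (rule finite_subset)
  show "{j. phi n r x (a - int (n * j)) * c j \<noteq> 0} \<subseteq> {..nat a}"
  proof
    fix j assume "j \<in> {j. phi n r x (a - int (n * j)) * c j \<noteq> 0}"
    hence "\<not> a - int (n * j) < 0"
      using phi_neg[of "a - int (n * j)" n r x] by auto
    moreover have "j \<le> n * j" using assms by simp
    ultimately show "j \<in> {..nat a}" by (simp only: atMost_iff)
  qed
qed simp

end

theory Submission
  imports Defs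
begin

(* Multiplying 1 / (x y - z) by (x y)^n - z^n = x^n - xi^n clears denominators, so that each entry
   of the matrix becomes a polynomial in y_i and z_j whose coefficients are the phi_m. Reducing it
   modulo y^n = 1 and z^n = xi^n factors the matrix as (Vandermonde matrix of y, with rows scaled by
   y_i^N) times (diagonal) times (Vandermonde matrix of z). *)

section \<open>Vandermonde determinants and the product of the roots of unity\<close>

lemma poly_eq_sum_lessThan:
  fixes p :: "'a::comm_ring_1 poly"
  assumes "degree p < n"
  shows "poly p x = (\<Sum>k<n. poly.coeff p k * x ^ k)"
  unfolding poly_altdef using assms
  by (intro sum.mono_neutral_left) (auto simp: coeff_eq_0)

lemma monic_prod_linear:
  fixes w :: "'b \<Rightarrow> 'a::idom"
  shows "degree (\<Prod>j\<in>A. [:- w j, 1:]) = card A" "lead_coeff (\<Prod>j\<in>A. [:- w j, 1:]) = 1"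
proof -
  show "degree (\<Prod>j\<in>A. [:- w j, 1:]) = card A"
    by (subst degree_prod_eq_sum_degree) auto
  show "lead_coeff (\<Prod>j\<in>A. [:- w j, 1:]) = 1"
    by (simp add: lead_coeff_prod)
qed

text \<open>Column operations with determinant 1 replace the powers by the Newton polynomials
  \<open>p i\<close>, monic of degree \<open>i\<close> with roots \<open>w j\<close> for
  \<open>j < i\<close>. Since \<open>p i\<close> vanishes at \<open>w a\<close> whenever
  \<open>a < i\<close>, the product matrix is lower triangular, and its diagonal gives the
  formula.\<close>

lemma det_vandermonde_rising:
  fixes w :: "nat \<Rightarrow> 'a::idom"
  shows "det (mat n n (\<lambda>(a, i). w a ^ i)) = (\<Prod>j<n. \<Prod>i<j. w j - w i)"
proof -
  define p where "p i = (\<Prod>j<i. [:- w j, 1:])" for i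
  define V where "V = mat n n (\<lambda>(a, i). w a ^ i)"
  define U where "U = mat n n (\<lambda>(k, i). poly.coeff (p i) k)"
  define L where "L = mat n n (\<lambda>(a, i). poly (p i) (w a))"
  have deg: "degree (p i) = i" and lead: "poly.coeff (p i) i = 1" for i
    using monic_prod_linear[of w "{..<i}"] by (simp_all add: p_def)
  have "V * U = L"
    by (rule eq_matI)
       (auto simp: V_def U_def L_def scalar_prod_def deg poly_eq_sum_lessThan[where n = n]
          lessThan_atLeast0 mult.commute)
  moreover have "det (V * U) = det V * det U"
    by (rule det_mult) (auto simp: V_def U_def)
  moreover have "det U = 1"
    by (subst det_upper_triangular[where n = n])
       (auto simp: U_def upper_triangular_def prod_list_diag_prod deg lead coeff_eq_0)
  moreover have "det L = (\<Prod>j<n. \<Prod>i<j. w j - w i)"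
    by (subst det_lower_triangular[where n = n])
       (auto simp: L_def p_def prod_list_diag_prod poly_prod lessThan_atLeast0)
  ultimately show ?thesis by (simp add: V_def)
qed

text \<open>Grouping the factors by the smaller index gives the diagonal entries that arise when
  powers fall along the rows.\<close>

lemma Delta_swap: "Delta n w = (\<Prod>i<n. \<Prod>j\<in>{i<..<n}. w i - w j)"
proof -
  have "Delta n w = (\<Prod>(j, i)\<in>(SIGMA j:{..<n}. {..<j}). w i - w j)"
    by (simp add: Delta_def prod.Sigma)
  also have "\<dots> = (\<Prod>(i, j)\<in>(SIGMA i:{..<n}. {i<..<n}). w i - w j)"
    by (rule prod.reindex_bij_witness[of _ prod.swap prod.swap]) auto
  finally show ?thesis by (simp add: prod.Sigma)
qed

text \<open>Mirror image of the rising case: unitriangular row operations turn row \<open>i\<close>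
  into the values of a monic polynomial of degree \<open>n - 1 - i\<close> whose roots are the
  \<open>w j\<close> with \<open>j > i\<close>. With falling powers the diagonal is exactly
  \<open>Delta\<close>, without a sign.\<close>

lemma det_vandermonde_falling:
  fixes w :: "nat \<Rightarrow> 'a::idom"
  shows "det (mat n n (\<lambda>(i, b). w b ^ (n - 1 - i))) = Delta n w"
proof -
  define p where "p i = (\<Prod>j\<in>{i<..<n}. [:- w j, 1:])" for i
  define V where "V = mat n n (\<lambda>(i, b). w b ^ (n - 1 - i))"
  define U where "U = mat n n (\<lambda>(i, k). poly.coeff (p i) (n - 1 - k))"
  define L where "L = mat n n (\<lambda>(i, b). poly (p i) (w b))"
  have deg: "degree (p i) = n - 1 - i" and lead: "poly.coeff (p i) (n - Suc i) = 1" for i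
    using monic_prod_linear[of w "{i<..<n}"] by (simp_all add: p_def)
  \<comment> \<open>Column \<open>k\<close> of \<open>U\<close> and row \<open>k\<close> of
    \<open>V\<close> both belong to the power \<open>n - 1 - k\<close>, so the matrix product
    evaluates \<open>p i\<close> with its terms in reverse order.\<close>
  have rev: "(\<Sum>k<n. f (n - Suc k)) = (\<Sum>k<n. f k)" for f :: "nat \<Rightarrow> 'a"
    by (rule sum.nat_diff_reindex)
  have "U * V = L"
  proof (rule eq_matI)
    fix i b assume "i < dim_row L" "b < dim_col L"
    then show "(U * V) $$ (i, b) = L $$ (i, b)"
      using rev[of "\<lambda>k. poly.coeff (p i) k * w b ^ k"]
      by (simp add: V_def U_def L_def scalar_prod_def deg poly_eq_sum_lessThan[where n = n]
          lessThan_atLeast0)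
  qed (auto simp: V_def U_def L_def)
  moreover have "det (U * V) = det U * det V"
    by (rule det_mult) (auto simp: V_def U_def)
  moreover have "det U = 1"
    by (subst det_upper_triangular[where n = n])
       (auto simp: U_def upper_triangular_def prod_list_diag_prod deg lead coeff_eq_0)
  moreover have "det L = Delta n w"
    unfolding Delta_swap
    by (subst det_lower_triangular[where n = n])
       (auto simp: L_def p_def prod_list_diag_prod poly_prod lessThan_atLeast0)
  ultimately show ?thesis by (simp add: V_def)
qed

lemma prod_diff_eq_sign_Delta:
  "(\<Prod>j<n. \<Prod>i<j. w j - w i) = (-1) ^ (n * (n - 1) div 2) * Delta n w"
proof -
  have "(\<Prod>j<n. \<Prod>i<j. w j - w i) = (\<Prod>j<n. \<Prod>i<j. (-1) * (w i - w j))"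
    by simp
  also have "\<dots> = (-1) ^ (\<Sum>j<n. j) * Delta n w"
    by (simp only: prod.distrib prod_constant Delta_def power_sum card_lessThan)
  also have "(\<Sum>j<n. j) = n * (n - 1) div 2"
    by (simp add: lessThan_atLeast0 Sum_Ico_nat)
  finally show ?thesis .
qed

lemma Delta_nonzero:
  fixes w :: "nat \<Rightarrow> 'a::idom"
  assumes "inj_on w {..<n}"
  shows "Delta n w \<noteq> 0"
  using assms by (auto simp: Delta_def inj_on_def)

text \<open>The polynomials \<open>p\<close> and \<open>q\<close> are monic of degree
  \<open>n\<close> and agree at \<open>n\<close> distinct points, hence are equal; comparing their
  constant terms gives the product.\<close>

lemma prod_roots_of_unity:
  fixes y :: "nat \<Rightarrow> 'a::field"
  assumes "n > 0" "inj_on y {..<n}" "\<And>i. i < n \<Longrightarrow> y i ^ n = 1"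
  shows "(\<Prod>i<n. y i) = (-1) ^ (n - 1)"
proof -
  define p where "p = (\<Prod>i<n. [:- y i, 1:])"
  define q :: "'a poly" where "q = monom 1 n - 1"
  have p: "degree p = n" "poly.coeff p n = 1"
    using monic_prod_linear[of y "{..<n}"] by (simp_all add: p_def)
  have "p = q"
  proof (rule poly_eqI_degree_lead_coeff[where n = n and A = "y ` {..<n}"])
    show "poly.coeff p n = poly.coeff q n"
      using p assms(1) by (simp add: q_def)
    show "degree q \<le> n"
      unfolding q_def by (intro degree_diff_le degree_monom_le) simp
    show "poly p u = poly q u" if "u \<in> y ` {..<n}" for u
      using that assms(3) by (auto simp: p_def q_def poly_prod poly_monom)
  qed (use p assms in \<open>auto simp: card_image\<close>)
  then have "poly p 0 = poly q 0" by simp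
  then have "(-1) ^ n * (\<Prod>i<n. y i) = -1"
    using assms(1) by (simp add: p_def q_def poly_prod poly_monom prod_uminus power_0_left)
  then have "(-1) ^ n * ((-1) ^ n * (\<Prod>i<n. y i)) = (-1) ^ n * (-1)"
    by simp
  then show ?thesis
    using assms(1) by (cases n) (simp_all flip: mult.assoc power_mult_distrib)
qed

section \<open>Exponent vectors and the expansion of a matrix entry\<close>

definition bounded_compositions :: "nat \<Rightarrow> nat \<Rightarrow> int \<Rightarrow> nat list set" where
  "bounded_compositions r m k =
     {alpha. length alpha = r \<and> set alpha \<subseteq> {..m} \<and> int (sum_list alpha) = k}"

lemma finite_bounded_compositions: "finite (bounded_compositions r m k)"
  by (rule finite_subset[OF _ finite_lists_length_eq[of "{..m}" r]])
     (auto simp: bounded_compositions_def)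

text \<open>Every bounded exponent vector is a rearrangement of exactly one partition, namely
  \<open>rev (sort alpha)\<close>, so the rearrangement classes split the exponent vectors
  disjointly. In this form \<open>phi n r x k\<close> is visibly the coefficient of t^k in the
  product of the sums 1 + x_l t + ... + (x_l t)^(n-1).\<close>

lemma phi_eq_sum_compositions:
  "phi n r x k = (\<Sum>alpha\<in>bounded_compositions r (n - 1) k. \<Prod>l<r. x l ^ (alpha ! l))"
proof -
  have sorted: "rev (sort mu) = mu" if "sorted_wrt (\<ge>) mu" for mu :: "nat list"
  proof -
    have "sorted (rev mu)" using that by (simp add: sorted_wrt_rev)
    then have "sort mu = rev mu" by (intro properties_for_sort) auto
    then show ?thesis by simp
  qed
  have "bounded_compositions r (n - 1) k =
      (\<Union>mu\<in>bounded_partitions r (n - 1) k. permutations_of_multiset (mset mu))"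
  proof (intro equalityI subsetI)
    fix alpha assume a: "alpha \<in> bounded_compositions r (n - 1) k"
    have "rev (sort alpha) \<in> bounded_partitions r (n - 1) k"
      using a by (auto simp: bounded_compositions_def bounded_partitions_def sorted_wrt_rev
          simp flip: sum_mset_sum_list)
    moreover have "alpha \<in> permutations_of_multiset (mset (rev (sort alpha)))"
      by (simp add: permutations_of_multiset_def)
    ultimately show "alpha \<in> (\<Union>mu\<in>bounded_partitions r (n - 1) k. permutations_of_multiset (mset mu))"
      by blast
  next
    fix alpha assume "alpha \<in> (\<Union>mu\<in>bounded_partitions r (n - 1) k. permutations_of_multiset (mset mu))"
    then obtain mu where mu: "mu \<in> bounded_partitions r (n - 1) k" "mset alpha = mset mu"
      by (auto simp: permutations_of_multiset_def)
    then have "set alpha = set mu" "length alpha = length mu" "sum_list alpha = sum_list mu"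
      by (auto dest: mset_eq_setD mset_eq_length simp flip: sum_mset_sum_list)
    with mu show "alpha \<in> bounded_compositions r (n - 1) k"
      by (auto simp: bounded_compositions_def bounded_partitions_def)
  qed
  moreover have "permutations_of_multiset (mset mu) \<inter> permutations_of_multiset (mset nu) = {}"
    if "mu \<in> bounded_partitions r (n - 1) k" "nu \<in> bounded_partitions r (n - 1) k" "mu \<noteq> nu"
    for mu nu
  proof (rule ccontr)
    assume "permutations_of_multiset (mset mu) \<inter> permutations_of_multiset (mset nu) \<noteq> {}"
    then have "mset mu = mset nu" by (auto simp: permutations_of_multiset_def)
    then have "sort mu = sort nu"
      by (metis mset_sort properties_for_sort sorted_sort)
    then show False
      using that sorted[of mu] sorted[of nu] by (simp add: bounded_partitions_def)
  qed
  ultimately show ?thesis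
    by (simp add: phi_def monomial_symmetric_def sum.UNION_disjoint finite_bounded_partitions)
qed

text \<open>Distributivity, with the choice functions encoded as lists to match the exponent vectors
  in \<open>bounded_compositions\<close>.\<close>

lemma prod_sum_lists:
  fixes f :: "nat \<Rightarrow> 'b \<Rightarrow> 'c::comm_semiring_1"
  assumes "finite A"
  shows "(\<Prod>k<r. \<Sum>a\<in>A. f k a) = (\<Sum>alpha | length alpha = r \<and> set alpha \<subseteq> A. \<Prod>k<r. f k (alpha ! k))"
proof -
  have "(\<Prod>k<r. \<Sum>a\<in>A. f k a) = (\<Sum>g\<in>{..<r} \<rightarrow>\<^sub>E A. \<Prod>k<r. f k (g k))"
    by (rule prod_sum_PiE) (auto simp: assms)
  also have "\<dots> = (\<Sum>alpha | length alpha = r \<and> set alpha \<subseteq> A. \<Prod>k<r. f k (alpha ! k))"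
    by (rule sum.reindex_bij_witness[of _ "\<lambda>alpha. restrict (nth alpha) {..<r}" "\<lambda>g. map g [0..<r]"])
       (auto simp: PiE_def extensional_def restrict_def fun_eq_iff intro!: nth_equalityI)
  finally show ?thesis .
qed

(* The exponents m = 0, ..., (n - 1) r of y are written uniquely as N + i - n j with i < n; the
   relations y^n = 1 and z^n = xi^n then turn y^m z^((n - 1) r - m) into
   y^(N + i) z^(n - 1 - i) xi^(n j). *)
lemma prod_inverse_eq_sum_phi:
  fixes x :: "nat \<Rightarrow> 'a::field"
  assumes "n > 0" "r > 0" and N: "N = (n - 1) * (r - 1)"
    and yn: "y ^ n = 1" and zn: "z ^ n = xi ^ n"
    and nz: "\<And>k. k < r \<Longrightarrow> x k ^ n \<noteq> xi ^ n"
  shows "(\<Prod>k<r. inverse (x k * y - z)) =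
    inverse (\<Prod>k<r. x k ^ n - xi ^ n) *
    (\<Sum>i<n. y ^ (N + i) *
      Sum_any (\<lambda>j. phi n r x (int N + int i - int (n * j)) * xi ^ (n * j)) * z ^ (n - 1 - i))"
proof -
  define X where "X alpha = (\<Prod>k<r. x k ^ (alpha ! k))" for alpha
  define C where "C i j = bounded_compositions r (n - 1) (int N + int i - int (n * j))" for i j
  \<comment> \<open>This is the total degree in \<open>y\<close> and \<open>z\<close> of every term
    of the expanded product.\<close>
  have Nr: "(n - 1) * r = N + n - 1"
    using assms(1,2) unfolding N by (cases r; cases n) auto
  \<comment> \<open>The two power relations give x_k^n - xi^n = (x_k y)^n - z^n, which is divisible
    by x_k y - z. As the left side is nonzero, so is that divisor.\<close>
  have inv: "inverse (x k * y - z) =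
      inverse (x k ^ n - xi ^ n) * (\<Sum>a\<le>n - 1. (x k * y) ^ a * z ^ (n - 1 - a))" if "k < r" for k
  proof -
    have "x k ^ n - xi ^ n = (x k * y) ^ n - z ^ n"
      by (simp add: yn zn power_mult_distrib)
    also have "\<dots> = (x k * y - z) * (\<Sum>a<n. z ^ (n - Suc a) * (x k * y) ^ a)"
      by (rule power_diff_sumr2)
    also have "(\<Sum>a<n. z ^ (n - Suc a) * (x k * y) ^ a) = (\<Sum>a\<le>n - 1. (x k * y) ^ a * z ^ (n - 1 - a))"
      using assms(1) by (intro sum.cong) (auto simp: mult.commute)
    finally have "x k ^ n - xi ^ n = (x k * y - z) * (\<Sum>a\<le>n - 1. (x k * y) ^ a * z ^ (n - 1 - a))" .
    moreover have "x k ^ n - xi ^ n \<noteq> 0" using nz[OF that] by simp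
    ultimately show ?thesis by simp
  qed
  have summand: "(\<Prod>k<r. (x k * y) ^ (alpha ! k) * z ^ (n - 1 - alpha ! k)) =
      X alpha * y ^ sum_list alpha * z ^ (N + n - 1 - sum_list alpha)"
    and le: "sum_list alpha \<le> N + n - 1"
    if "length alpha = r" "set alpha \<subseteq> {..n - 1}" for alpha
  proof -
    have s: "(\<Sum>k<r. alpha ! k) = sum_list alpha"
      using that by (simp add: sum_list_sum_nth lessThan_atLeast0)
    have le': "alpha ! k \<le> n - 1" if "k < r" for k
      using that subsetD[OF \<open>set alpha \<subseteq> {..n - 1}\<close> nth_mem] \<open>length alpha = r\<close> by simp
    \<comment> \<open>Natural subtraction distributes over the sum because every part is at most
      \<open>n - 1\<close>.\<close>
    have "(\<Sum>k<r. n - 1 - alpha ! k) = (\<Sum>k<r. n - 1) - (\<Sum>k<r. alpha ! k)"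
      using le' by (intro sum_subtractf_nat) auto
    then have "(\<Sum>k<r. n - 1 - alpha ! k) = N + n - 1 - sum_list alpha"
      by (simp only: s sum_constant card_lessThan of_nat_id mult.commute[of r] Nr)
    then show "(\<Prod>k<r. (x k * y) ^ (alpha ! k) * z ^ (n - 1 - alpha ! k)) =
        X alpha * y ^ sum_list alpha * z ^ (N + n - 1 - sum_list alpha)"
      by (simp add: X_def power_mult_distrib prod.distrib s flip: power_sum)
    have "sum_list alpha \<le> (\<Sum>k<r. n - 1)"
      unfolding s[symmetric] using le' by (intro sum_mono) auto
    then show "sum_list alpha \<le> N + n - 1"
      using Nr by (simp add: mult.commute)
  qed
  have "(\<Prod>k<r. \<Sum>a\<le>n - 1. (x k * y) ^ a * z ^ (n - 1 - a)) =
      (\<Sum>alpha | length alpha = r \<and> set alpha \<subseteq> {..n - 1}.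
        X alpha * y ^ sum_list alpha * z ^ (N + n - 1 - sum_list alpha))"
    unfolding prod_sum_lists[OF finite_atMost]
    by (intro sum.cong refl) (elim CollectE conjE, rule summand)
  also have "{alpha. length alpha = r \<and> set alpha \<subseteq> {..n - 1}} =
      (\<Union>(i, j)\<in>{..<n} \<times> {..N + n}. C i j)"
  proof (intro equalityI subsetI)
    fix alpha assume "alpha \<in> {alpha. length alpha = r \<and> set alpha \<subseteq> {..n - 1}}"
    then have a: "length alpha = r" "set alpha \<subseteq> {..n - 1}" by auto
    \<comment> \<open>\<open>t\<close> is the exponent of \<open>z\<close>. Dividing it by
      \<open>n\<close> gives the quotient \<open>j\<close> and the remainder
      \<open>n - 1 - i\<close>; the range \<open>{..N + n}\<close> is a crude bound on the quotient
      that keeps the index set finite.\<close>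
    define t where "t = N + n - 1 - sum_list alpha"
    have t: "int N + int n - 1 = int (sum_list alpha) + int t"
      using le[OF a] assms(1) unfolding t_def by linarith
    have "int t = int (n * (t div n)) + int (t mod n)"
      by (metis of_nat_add mult_div_mod_eq)
    moreover have "t mod n < n" using assms(1) by simp
    ultimately have "int (sum_list alpha) = int N + int (n - 1 - t mod n) - int (n * (t div n))"
      using t by linarith
    then have "alpha \<in> C (n - 1 - t mod n) (t div n)"
      using a by (simp add: C_def bounded_compositions_def)
    moreover have "t div n \<le> N + n"
      by (rule order_trans[OF div_le_dividend]) (simp add: t_def)
    ultimately show "alpha \<in> (\<Union>(i, j)\<in>{..<n} \<times> {..N + n}. C i j)"
      using assms(1) by (intro UN_I[of "(n - 1 - t mod n, t div n)"]) auto
  qed (auto simp: C_def bounded_compositions_def)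
  also have "(\<Sum>alpha\<in>(\<Union>(i, j)\<in>{..<n} \<times> {..N + n}. C i j).
        X alpha * y ^ sum_list alpha * z ^ (N + n - 1 - sum_list alpha)) =
      (\<Sum>(i, j)\<in>{..<n} \<times> {..N + n}. \<Sum>alpha\<in>C i j.
        X alpha * y ^ sum_list alpha * z ^ (N + n - 1 - sum_list alpha))"
  proof (subst sum.UNION_disjoint)
    show "\<forall>p\<in>{..<n} \<times> {..N + n}. \<forall>q\<in>{..<n} \<times> {..N + n}. p \<noteq> q \<longrightarrow>
      (case p of (i, j) \<Rightarrow> C i j) \<inter> (case q of (i, j) \<Rightarrow> C i j) = {}"
    \<comment> \<open>A common element would give \<open>i + n * j' = i' + n * j\<close>; reduction
      modulo \<open>n\<close> yields \<open>i = i'\<close>, and then \<open>j = j'\<close>.\<close>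
    proof (clarsimp, rule ccontr)
      fix i j i' j' assume lt: "i < n" "i' < n" and ne: "i = i' \<longrightarrow> j \<noteq> j'"
        and "C i j \<inter> C i' j' \<noteq> {}"
      then have "int i - int (n * j) = int i' - int (n * j')"
        by (auto simp: C_def bounded_compositions_def)
      then have eq: "i + n * j' = i' + n * j" by linarith
      then have "(i + n * j') mod n = (i' + n * j) mod n" by simp
      then have "i = i'" using lt by simp
      then show False using eq ne lt by simp
    qed
  qed (auto simp: C_def finite_bounded_compositions case_prod_beta)
  also have "\<dots> = (\<Sum>(i, j)\<in>{..<n} \<times> {..N + n}. \<Sum>alpha\<in>C i j.
        X alpha * (y ^ (N + i) * z ^ (n - 1 - i) * xi ^ (n * j)))"
  proof (rule sum.cong[OF refl], unfold split_beta, rule sum.cong[OF refl])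
    fix p alpha assume p: "p \<in> {..<n} \<times> {..N + n}" "alpha \<in> C (fst p) (snd p)"
    define i j where "i = fst p" and "j = snd p"
    then have i: "i < n" and "alpha \<in> C i j" using p by auto
    then have s: "int (sum_list alpha) = int N + int i - int (n * j)"
      by (simp add: C_def bounded_compositions_def)
    then have "N + i = sum_list alpha + n * j" by linarith
    then have "y ^ (N + i) = y ^ sum_list alpha"
      by (simp add: power_add power_mult yn)
    moreover have "N + n - 1 - sum_list alpha = (n - 1 - i) + n * j"
      using s i by linarith
    then have "z ^ (N + n - 1 - sum_list alpha) = z ^ (n - 1 - i) * xi ^ (n * j)"
      by (simp add: power_add power_mult zn)
    ultimately show "X alpha * y ^ sum_list alpha * z ^ (N + n - 1 - sum_list alpha) =
        X alpha * (y ^ (N + fst p) * z ^ (n - 1 - fst p) * xi ^ (n * snd p))"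
      unfolding i_def j_def by (simp add: mult.assoc)
  qed
  also have "\<dots> = (\<Sum>i<n. \<Sum>j\<le>N + n. \<Sum>alpha\<in>C i j.
        X alpha * (y ^ (N + i) * z ^ (n - 1 - i) * xi ^ (n * j)))"
    by (simp add: sum.cartesian_product)
  also have "\<dots> = (\<Sum>i<n. y ^ (N + i) *
      Sum_any (\<lambda>j. phi n r x (int N + int i - int (n * j)) * xi ^ (n * j)) * z ^ (n - 1 - i))"
  proof (intro sum.cong refl)
    fix i assume "i \<in> {..<n}"
    then have i: "i < n" by simp
    have "Sum_any (\<lambda>j. phi n r x (int N + int i - int (n * j)) * xi ^ (n * j)) =
        (\<Sum>j\<le>N + n. phi n r x (int N + int i - int (n * j)) * xi ^ (n * j))"
    \<comment> \<open>For \<open>j > N + n\<close> the index \<open>N + i - n * j\<close> is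
      negative, because \<open>i < n\<close> and \<open>j \<le> n * j\<close>, and there
      \<open>phi\<close> vanishes.\<close>
    proof (rule Sum_any.expand_superset)
      show "{j. phi n r x (int N + int i - int (n * j)) * xi ^ (n * j) \<noteq> 0} \<subseteq> {..N + n}"
      proof (rule subsetI, rule ccontr)
        fix j assume j: "j \<in> {j. phi n r x (int N + int i - int (n * j)) * xi ^ (n * j) \<noteq> 0}"
          and "j \<notin> {..N + n}"
        moreover have "j \<le> n * j" using assms(1) by simp
        ultimately have "int N + int i - int (n * j) < 0" using i unfolding atMost_iff by linarith
        with j show False by (simp add: phi_neg)
      qed
    qed simp
    also have "\<dots> = (\<Sum>j\<le>N + n. \<Sum>alpha\<in>C i j. X alpha * xi ^ (n * j))"
      by (simp add: phi_eq_sum_compositions X_def C_def sum_distrib_right)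
    finally show "(\<Sum>j\<le>N + n. \<Sum>alpha\<in>C i j. X alpha * (y ^ (N + i) * z ^ (n - 1 - i) * xi ^ (n * j))) =
        y ^ (N + i) * Sum_any (\<lambda>j. phi n r x (int N + int i - int (n * j)) * xi ^ (n * j)) * z ^ (n - 1 - i)"
      by (simp add: sum_distrib_left sum_distrib_right ac_simps)
  qed
  finally show ?thesis
    by (simp add: inv prod.distrib flip: prod_inversef)
qed

section \<open>Factorization of the matrix and evaluation of its determinant\<close>

lemma det_factor_three:
  fixes A B :: "nat \<Rightarrow> nat \<Rightarrow> 'a::idom"
  shows "det (mat n n (\<lambda>(a, b). \<Sum>i<n. A a i * d i * B i b)) =
    det (mat n n (\<lambda>(a, i). A a i)) * (\<Prod>i<n. d i) * det (mat n n (\<lambda>(i, b). B i b))"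
proof -
  define D where "D = mat n n (\<lambda>(i, j). if i = j then d i else 0)"
  define P where "P = mat n n (\<lambda>(a, i). A a i)"
  define Q where "Q = mat n n (\<lambda>(i, b). B i b)"
  have "P * D = mat n n (\<lambda>(a, i). A a i * d i)"
    by (rule eq_matI) (auto simp: P_def D_def scalar_prod_def if_distrib sum.delta cong: if_cong)
  then have "P * D * Q = mat n n (\<lambda>(a, b). \<Sum>i<n. A a i * d i * B i b)"
    by (intro eq_matI) (auto simp: Q_def scalar_prod_def lessThan_atLeast0)
  moreover have "det (P * D * Q) = det P * det D * det Q"
    by (subst det_mult[where n = n]; (subst det_mult[where n = n])?) (auto simp: P_def D_def Q_def)
  moreover have "det D = (\<Prod>i<n. d i)"
    by (subst det_upper_triangular[where n = n])
       (auto simp: D_def upper_triangular_def prod_list_diag_prod lessThan_atLeast0)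
  ultimately show ?thesis by (simp add: P_def Q_def)
qed

text \<open>The identity over an arbitrary field, with the Vandermonde products kept on the right so
  that nothing is divided by them. The sign has two sources: \<open>n * (n - 1) div 2\<close>
  reversed differences in the Vandermonde determinant of \<open>y\<close>, and the row factors
  \<open>y a ^ N\<close>.\<close>

lemma det_prod_inverse_eq:
  fixes x y z :: "nat \<Rightarrow> 'a::field"
  assumes "n > 0" "r > 0" and N: "N = (n - 1) * (r - 1)"
    and y: "inj_on y {..<n}" "\<And>i. i < n \<Longrightarrow> y i ^ n = 1"
    and z: "\<And>i. i < n \<Longrightarrow> z i ^ n = xi ^ n"
    and nz: "\<And>k. k < r \<Longrightarrow> x k ^ n \<noteq> xi ^ n"
  shows "det (mat n n (\<lambda>(i, j). \<Prod>k<r. inverse (x k * y i - z j))) =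
    (-1) ^ (n * (n - 1) div 2 + (n - 1) * (r - 1)) / (\<Prod>k<r. (x k ^ n - xi ^ n) ^ n) *
    (\<Prod>i<n. Sum_any (\<lambda>j. phi n r x (int N + int i - int (n * j)) * xi ^ (n * j))) *
    (Delta n y * Delta n z)"
proof -
  define S where "S i = Sum_any (\<lambda>j. phi n r x (int N + int i - int (n * j)) * xi ^ (n * j))" for i
  define c where "c = inverse (\<Prod>k<r. x k ^ n - xi ^ n)"
  \<comment> \<open>The common denominator \<open>c\<close> is absorbed into the diagonal factor, so
    it contributes \<open>c ^ n\<close> to the determinant and produces the exponent
    \<open>n\<close> in the final denominator.\<close>
  have "mat n n (\<lambda>(a, b). \<Prod>k<r. inverse (x k * y a - z b)) =
      mat n n (\<lambda>(a, b). \<Sum>i<n. y a ^ (N + i) * (c * S i) * z b ^ (n - 1 - i))"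
    by (rule cong_mat)
       (simp_all add: prod_inverse_eq_sum_phi[OF assms(1,2) N y(2) z nz] S_def c_def
          sum_distrib_left ac_simps)
  then have "det (mat n n (\<lambda>(a, b). \<Prod>k<r. inverse (x k * y a - z b))) =
      det (mat n n (\<lambda>(a, i). y a ^ (N + i))) * (c ^ n * (\<Prod>i<n. S i)) * Delta n z"
    by (simp add: det_factor_three det_vandermonde_falling[simplified] prod.distrib)
  also have "det (mat n n (\<lambda>(a, i). y a ^ (N + i))) =
      (\<Prod>a<n. y a ^ N) * ((-1) ^ (n * (n - 1) div 2) * Delta n y)"
  proof -
    define D where "D = mat n n (\<lambda>(a, b). if a = b then y a ^ N else 0)"
    have "mat n n (\<lambda>(a, i). y a ^ (N + i)) = D * mat n n (\<lambda>(a, i). y a ^ i)"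
      by (rule eq_matI)
         (auto simp: D_def scalar_prod_def power_add if_distrib[of "\<lambda>t. t * _"] cong: if_cong)
    moreover have "det D = (\<Prod>a<n. y a ^ N)"
      by (subst det_upper_triangular[where n = n])
         (auto simp: D_def upper_triangular_def prod_list_diag_prod lessThan_atLeast0)
    ultimately show ?thesis
      by (subst det_vandermonde_rising[of n y, unfolded prod_diff_eq_sign_Delta, symmetric])
         (simp add: det_mult[where n = n] D_def)
  qed
  also have "(\<Prod>a<n. y a ^ N) = (-1) ^ ((n - 1) * (r - 1))"
  proof -
    have "(\<Prod>a<n. y a ^ N) = ((-1) ^ (n - 1)) ^ N"
      using prod_roots_of_unity[OF assms(1) y] by (simp flip: prod_power_distrib)
    also have "\<dots> = (((-1) ^ (n - 1)) ^ (n - 1)) ^ (r - 1)"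
      by (simp only: N power_mult)
    \<comment> \<open>The square of \<open>n - 1\<close> has the same parity as
      \<open>n - 1\<close>.\<close>
    also have "((-1) ^ (n - 1)) ^ (n - 1) = ((-1) ^ (n - 1) :: 'a)"
      by (cases "even (n - 1)") simp_all
    finally show ?thesis by (simp only: power_mult)
  qed
  also have "c ^ n = inverse (\<Prod>k<r. (x k ^ n - xi ^ n) ^ n)"
    by (simp add: c_def power_inverse prod_power_distrib)
  finally show ?thesis
    by (simp add: S_def divide_inverse power_add ac_simps)
qed

section \<open>Powers of indeterminates and the specialization to rational functions\<close>

lemma indet_power:
  "indet k ^ n = Fract (Poly_Mapping.single (Poly_Mapping.single k n) 1) 1"
proof (induction n)
  case 0
  then show ?case by (simp add: One_fract_def)
next
  case (Suc n)
  then show ?case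
    by (simp add: indet_def Poly_Mapping.mult_single flip: Poly_Mapping.single_add)
qed

text \<open>Ensures that the denominators x_k^n - xi^n are nonzero. Both powers are single
  monomials, so equality forces equal exponent maps; as \<open>n > 0\<close>, these have the
  nonempty supports {k} and {l}.\<close>

lemma indet_power_eq_iff:
  assumes "n > 0"
  shows "(indet k :: 'a::idom ratfun) ^ n = indet l ^ n \<longleftrightarrow> k = l"
proof
  assume "(indet k :: 'a ratfun) ^ n = indet l ^ n"
  then have eq: "Poly_Mapping.single (Poly_Mapping.single k n) (1::'a) =
      Poly_Mapping.single (Poly_Mapping.single l n) 1"
    by (simp add: indet_power eq_fract)
  then have "Poly_Mapping.single k n = Poly_Mapping.single l n"
    by (metis lookup_single_eq lookup_single_not_eq zero_neq_one)
  then show "k = l"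
    using assms by (metis lookup_single_eq lookup_single_not_eq less_irrefl)
qed simp

theorem theorem1:
  fixes n r N :: nat
    and x :: "nat \<Rightarrow> 'a::{alg_closed_field, field_char_0} ratfun"
    and xi :: "'a ratfun"
    and y z :: "nat \<Rightarrow> 'a ratfun"
  assumes "n > 0" and "r > 0"
    and "N = (n - 1) * (r - 1)"
    and "xi = indet 0"
    and "\<And>k. x k = indet (Suc k)"
    and "bij_betw y {..<n} {w. w ^ n - 1 = 0}"
    and "bij_betw z {..<n} {w. w ^ n - xi ^ n = 0}"
  shows "inverse (Delta n y) * inverse (Delta n z) *
           det (mat n n (\<lambda>(i, j). \<Prod>k<r. inverse (x k * y i - z j))) =
         (-1) ^ (n * (n - 1) div 2 + (n - 1) * (r - 1)) / (\<Prod>k<r. (x k ^ n - xi ^ n) ^ n) *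
         (\<Prod>i<n. Sum_any (\<lambda>j::nat. phi n r x (int N + int i - int (n * j)) * xi ^ (n * j)))"
proof -
  \<comment> \<open>The premise \<open>i < n\<close> attaches to injectivity as well; it is
    discharged below at \<open>i = 0\<close>, using \<open>n > 0\<close>.\<close>
  have y: "inj_on y {..<n}" "y i ^ n = 1" if "i < n" for i
    using assms(6) that by (auto simp: bij_betw_def)
  have z: "inj_on z {..<n}" "z i ^ n = xi ^ n" if "i < n" for i
    using assms(7) that by (auto simp: bij_betw_def)
  have "x k ^ n \<noteq> xi ^ n" for k
    using assms(1) by (simp add: assms(4,5) indet_power_eq_iff)
  note det = det_prod_inverse_eq[OF assms(1-3) y(1)[OF assms(1)] y(2) z(2) this]
  \<comment> \<open>The enumerated roots are distinct, so both Vandermonde products can be cancelled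
    against their inverses.\<close>
  have "Delta n y \<noteq> 0" "Delta n z \<noteq> 0"
    using Delta_nonzero y(1)[OF assms(1)] z(1)[OF assms(1)] by blast+
  then show ?thesis
    by (simp only: det) (simp add: divide_simps)
qed

end
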